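(* Let $[A],[B]\in\hat V_J$. Then $\mathbb{C}\mathcal{O}^l_A\cong\mathbb{C}\mathcal{O}^l_B$ (as left $\mathbb{C}U_J$-modules) and $\mathbb{C}\mathcal{O}^r_A\cong\mathbb{C}\mathcal{O}^r_B$ (as right $\mathbb{C}U_J$-modules) if and only if $\mathcal{O}^{bi}_A=\mathcal{O}^{bi}_B$. Consequently, distinct biorbits of $\hat V_J$ afford orthogonal characters.
   Context: Let $n\ge 1$, let $q$ be a prime power, $\Phi^+=\{(i,j)\mid 1\le i<j\le n\}$, and let $J\subseteq\Phi^+$ be closed, i.e. $(i,j),(j,k)\in J$ implies $(i,k)\in J$. Let $E$ be the identity matrix in $M_n(q)=M_n(\mathbb{F}_q)$. Set $V_J=\{A\in M_n(q)\mid A_{ij}\ne 0\Rightarrow (i,j)\in J\}$ and $U_J=\{u\in M_n(q)\mid u-E\in V_J\}$, a group (pattern subgroup). Let $\pi_J:M_n(q)\to V_J$ be the projection which sets all entries outside $J$ to zero. Fix a nontrivial linear character $\theta:(\mathbb{F}_q,+)\to\mathbb{C}^*$. For $A\in V_J$ let $A^*:V_J\to\mathbb{F}_q$, $A^*(B)=\sum_{(i,j)\in J}A_{ij}B_{ij}$, and $[A]=\theta\circ A^*$; then $A\mapsto[A]$ is a bijection from $V_J$ onto the set $\hat V_J$ of linear complex characters of $(V_J,+)$. $U_J$ acts on $\hat V_J$ from both sides by permutations (dot action): $u.[A].v=[\pi_J(u^{-t}Av^{-t})]$ with $u^{-t}=(u^{-1})^t$; equivalently $(u.[A].v)(B)=[A](u^{-1}Bv^{-1})$.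 Put $\mathcal{O}^l_A=U_J.[A]$, $\mathcal{O}^r_A=[A].U_J$, $\mathcal{O}^{bi}_A=U_J.[A].U_J$ (left orbit, right orbit, biorbit). The vector space $\mathbb{C}\hat V_J$ with basis $\hat V_J$ is a $\mathbb{C}U_J$-bimodule via the monomial action $u[A]=\theta(A^*(u^{-1}-E))\,u.[A]$ and $[A]u=\theta(A^*(u^{-1}-E))\,[A].u$. For an orbit $\mathcal{O}\subseteq\hat V_J$ (left, right or biorbit), $\mathbb{C}\mathcal{O}$ denotes its complex span, a left module, right module or bimodule under the monomial action, respectively. The characters afforded by an orbit are the characters of $U_J$ afforded by the corresponding orbit module (for a biorbit $\mathcal{O}$: by $\mathbb{C}\mathcal{O}$ as a left, respectively right, module); orthogonality is with respect to the usual inner product of characters. *)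

theory Defs
  imports "HOL-Analysis.Analysis"
begin

text \<open>
  The index set of the matrices is a finite linearly ordered type \<open>'n\<close> in place of
  \<open>{1,\<dots>,n}\<close>, where \<open>n = CARD('n)\<close>, and \<open>\<F>\<^sub>q\<close> is a type \<open>'a\<close> of class \<open>{field, finite}\<close>.
  The matrix ring \<open>M\<^sub>n(q)\<close> is then \<open>'a ^ 'n ^ 'n\<close>, with identity matrix \<open>mat 1\<close>.
\<close>

definition positive_roots :: "('n::{finite,linorder} \<times> 'n) set"
  where "positive_roots = {(i, j). i < j}"

definition pattern_space :: "('n::finite \<times> 'n) set \<Rightarrow> ('a::zero ^ 'n ^ 'n) set"
  where "pattern_space J = {A. \<forall>i j. A $ i $ j \<noteq> 0 \<longrightarrow> (i, j) \<in> J}"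

definition pattern_group :: "('n::finite \<times> 'n) set \<Rightarrow> ('a::field ^ 'n ^ 'n) set"
  where "pattern_group J = {u. u - mat 1 \<in> pattern_space J}"

definition pattern_proj :: "('n::finite \<times> 'n) set \<Rightarrow> 'a::zero ^ 'n ^ 'n \<Rightarrow> 'a ^ 'n ^ 'n"
  where "pattern_proj J A = (\<chi> i j. if (i, j) \<in> J then A $ i $ j else 0)"


subsection \<open>Linear characters\<close>

text \<open>
  Characters of a subgroup \<open>V\<close> of an additive group. Being \<open>extensional\<close> makes
  equality of characters mean equality on \<open>V\<close>.
\<close>

definition linear_characters :: "'v::ab_group_add set \<Rightarrow> ('v \<Rightarrow> complex) set"
  where "linear_characters V =
    {\<psi> \<in> extensional V. (\<forall>x\<in>V. \<psi> x \<noteq> 0) \<and> (\<forall>x\<in>V. \<forall>y\<in>V. \<psi> (x + y) = \<psi> x * \<psi> y)}"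

type_synonym ('a, 'n) mchar = "'a ^ 'n ^ 'n \<Rightarrow> complex"

abbreviation dual :: "('n::finite \<times> 'n) set \<Rightarrow> ('a::field, 'n) mchar set"
  where "dual J \<equiv> linear_characters (pattern_space J)"

definition star :: "('n::finite \<times> 'n) set \<Rightarrow> 'a::field ^ 'n ^ 'n \<Rightarrow> 'a ^ 'n ^ 'n \<Rightarrow> 'a"
  where "star J A B = (\<Sum>(i, j)\<in>J. A $ i $ j * B $ i $ j)"

text \<open>\<open>mchar_of \<theta> J A\<close> is the character \<open>[A] = \<theta> \<circ> A\<^sup>*\<close> of \<open>V\<^sub>J\<close>.\<close>

definition mchar_of ::
    "('a::field \<Rightarrow> complex) \<Rightarrow> ('n::finite \<times> 'n) set \<Rightarrow> 'a ^ 'n ^ 'n \<Rightarrow> ('a, 'n) mchar"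
  where "mchar_of \<theta> J A = restrict (\<lambda>B. \<theta> (star J A B)) (pattern_space J)"


subsection \<open>Dot action and orbits\<close>

text \<open>
  The dot action \<open>u.\<psi>.v\<close> is given on characters; \<open>dot_mchar_of\<close> below shows that on \<open>[A]\<close>
  it is \<open>[\<pi>\<^sub>J(u\<^sup>-\<^sup>t A v\<^sup>-\<^sup>t)]\<close>.
\<close>

definition dot ::
    "('n::finite \<times> 'n) set \<Rightarrow> 'a::field ^ 'n ^ 'n \<Rightarrow> ('a, 'n) mchar \<Rightarrow> 'a ^ 'n ^ 'n \<Rightarrow> ('a, 'n) mchar"
  where "dot J u \<psi> v = restrict (\<lambda>B. \<psi> (matrix_inv u ** B ** matrix_inv v)) (pattern_space J)"

definition left_orbit :: "('n::finite \<times> 'n) set \<Rightarrow> ('a::field, 'n) mchar \<Rightarrow> ('a, 'n) mchar set"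
  where "left_orbit J \<psi> = {dot J u \<psi> (mat 1) |u. u \<in> pattern_group J}"

definition right_orbit :: "('n::finite \<times> 'n) set \<Rightarrow> ('a::field, 'n) mchar \<Rightarrow> ('a, 'n) mchar set"
  where "right_orbit J \<psi> = {dot J (mat 1) \<psi> v |v. v \<in> pattern_group J}"

definition biorbit :: "('n::finite \<times> 'n) set \<Rightarrow> ('a::field, 'n) mchar \<Rightarrow> ('a, 'n) mchar set"
  where "biorbit J \<psi> = {dot J u \<psi> v |u v. u \<in> pattern_group J \<and> v \<in> pattern_group J}"

definition biorbits :: "('n::finite \<times> 'n) set \<Rightarrow> ('a::field, 'n) mchar set set"
  where "biorbits J = biorbit J ` dual J"

lemma star_pattern_proj:
  fixes A B P Q :: "'a::field ^ 'n ^ 'n"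
  assumes A: "A \<in> pattern_space J" and B: "B \<in> pattern_space J"
  shows "star J A (P ** B ** Q) = star J (pattern_proj J (transpose P ** A ** transpose Q)) B"
proof -
  have ext: "star J C D = (\<Sum>i\<in>UNIV. \<Sum>j\<in>UNIV. C $ i $ j * D $ i $ j)"
    if "C \<in> pattern_space J \<or> D \<in> pattern_space J" for C D :: "'a ^ 'n ^ 'n"
  proof -
    have "star J C D = (\<Sum>(i, j)\<in>UNIV. C $ i $ j * D $ i $ j)"
      unfolding star_def
      by (rule sum.mono_neutral_left) (use that in \<open>fastforce simp: pattern_space_def\<close>)+
    also have "\<dots> = (\<Sum>i\<in>UNIV. \<Sum>j\<in>UNIV. C $ i $ j * D $ i $ j)"
      by (simp add: sum.cartesian_product)
    finally show ?thesis .
  qed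
  have "star J (pattern_proj J (transpose P ** A ** transpose Q)) B
      = star J (transpose P ** A ** transpose Q) B"
    unfolding star_def pattern_proj_def by (rule sum.cong) auto
  also have "\<dots> = (\<Sum>k\<in>UNIV. \<Sum>l\<in>UNIV. \<Sum>j\<in>UNIV. \<Sum>i\<in>UNIV. P $ i $ k * A $ i $ j * Q $ l $ j * B $ k $ l)"
    by (simp add: ext B matrix_matrix_mult_def transpose_def sum_distrib_right)
  also have "\<dots> = (\<Sum>k\<in>UNIV. \<Sum>j\<in>UNIV. \<Sum>l\<in>UNIV. \<Sum>i\<in>UNIV. P $ i $ k * A $ i $ j * Q $ l $ j * B $ k $ l)"
    by (rule sum.cong[OF refl], rule sum.swap)
  also have "\<dots> = (\<Sum>j\<in>UNIV. \<Sum>k\<in>UNIV. \<Sum>l\<in>UNIV. \<Sum>i\<in>UNIV. P $ i $ k * A $ i $ j * Q $ l $ j * B $ k $ l)"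
    by (rule sum.swap)
  also have "\<dots> = (\<Sum>j\<in>UNIV. \<Sum>k\<in>UNIV. \<Sum>i\<in>UNIV. \<Sum>l\<in>UNIV. P $ i $ k * A $ i $ j * Q $ l $ j * B $ k $ l)"
    by (rule sum.cong[OF refl], rule sum.cong[OF refl], rule sum.swap)
  also have "\<dots> = (\<Sum>j\<in>UNIV. \<Sum>i\<in>UNIV. \<Sum>k\<in>UNIV. \<Sum>l\<in>UNIV. P $ i $ k * A $ i $ j * Q $ l $ j * B $ k $ l)"
    by (rule sum.cong[OF refl], rule sum.swap)
  also have "\<dots> = (\<Sum>i\<in>UNIV. \<Sum>j\<in>UNIV. \<Sum>k\<in>UNIV. \<Sum>l\<in>UNIV. P $ i $ k * A $ i $ j * Q $ l $ j * B $ k $ l)"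
    by (rule sum.swap)
  also have "\<dots> = (\<Sum>i\<in>UNIV. \<Sum>j\<in>UNIV. \<Sum>l\<in>UNIV. \<Sum>k\<in>UNIV. P $ i $ k * A $ i $ j * Q $ l $ j * B $ k $ l)"
    by (rule sum.cong[OF refl], rule sum.cong[OF refl], rule sum.swap)
  also have "\<dots> = (\<Sum>i\<in>UNIV. \<Sum>j\<in>UNIV. \<Sum>l\<in>UNIV. \<Sum>k\<in>UNIV. A $ i $ j * (P $ i $ k * B $ k $ l * Q $ l $ j))"
    by (intro sum.cong refl) (simp only: mult_ac)
  also have "\<dots> = star J A (P ** B ** Q)"
    by (simp add: ext A matrix_matrix_mult_def sum_distrib_left sum_distrib_right)
  finally show ?thesis by simp
qed

lemma matrix_diff_ldistrib: "A ** (B - C) = A ** B - A ** (C :: 'a::ring_1 ^ 'n ^ 'm)"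
  by (simp add: matrix_matrix_mult_def vec_eq_iff right_diff_distrib sum_subtractf)

lemma matrix_diff_rdistrib: "(A - B) ** C = A ** C - B ** (C :: 'a::ring_1 ^ 'n ^ 'm)"
  by (simp add: matrix_matrix_mult_def vec_eq_iff left_diff_distrib sum_subtractf)

lemma matrix_mult_pattern_space:
  fixes A B :: "'a::field ^ 'n ^ 'n"
  assumes "trans J" "A \<in> pattern_space J" "B \<in> pattern_space J"
  shows "A ** B \<in> pattern_space J"
  unfolding pattern_space_def
proof (intro CollectI allI impI)
  fix i j
  assume "(A ** B) $ i $ j \<noteq> 0"
  then have "(\<Sum>k\<in>UNIV. A $ i $ k * B $ k $ j) \<noteq> 0"
    by (simp add: matrix_matrix_mult_def)
  then obtain k where "A $ i $ k * B $ k $ j \<noteq> 0"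
    using sum.neutral[of UNIV "\<lambda>k. A $ i $ k * B $ k $ j"] by blast
  then have "(i, k) \<in> J" "(k, j) \<in> J"
    using assms(2,3) by (auto simp: pattern_space_def)
  with \<open>trans J\<close> show "(i, j) \<in> J" by (rule transD)
qed

lemma pattern_space_add:
  fixes A B :: "'a::field ^ 'n ^ 'n"
  shows "A \<in> pattern_space J \<Longrightarrow> B \<in> pattern_space J \<Longrightarrow> A + B \<in> pattern_space J"
  by (force simp: pattern_space_def)

lemma matrix_inv_pattern_group:
  fixes u :: "'a::{field,finite} ^ 'n::{finite,linorder} ^ 'n::{finite,linorder}"
  assumes J: "J \<subseteq> positive_roots" "trans J" and u: "u \<in> pattern_group J"
  shows "matrix_inv u \<in> pattern_group J"
    and "u ** matrix_inv u = mat 1" "matrix_inv u ** u = mat 1"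
proof -
  let ?U = "pattern_group J :: (('a, 'n) vec, 'n) vec set"
  have zero: "X = 0" if X: "u ** X = 0" for X :: "(('a, 'n) vec, 'n) vec"
  proof (rule ccontr)
    assume "X \<noteq> 0"
    define R where "R = {i. X $ i \<noteq> 0}"
    have "R \<noteq> {}" "finite R"
      using \<open>X \<noteq> 0\<close> by (auto simp: R_def vec_eq_iff)
    define i where "i = Max R"
    have "i \<in> R" unfolding i_def by (rule Max_in) fact+
    then obtain j where j: "X $ i $ j \<noteq> 0"
      by (auto simp: R_def vec_eq_iff)
    have "u $ i $ k * X $ k $ j = (if k = i then X $ i $ j else 0)" for k
    proof (cases "X $ k $ j = 0")
      case True
      with j show ?thesis by auto
    next
      case False
      then have "k \<in> R" by (auto simp: R_def)
      then have "k \<le> i" unfolding i_def using \<open>finite R\<close> by simp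
      then have "(i, k) \<notin> J" using J(1) by (auto simp: positive_roots_def)
      then have "(u - mat 1) $ i $ k = 0"
        using u by (auto simp: pattern_group_def pattern_space_def)
      then show ?thesis by (auto simp: mat_def)
    qed
    then have "(u ** X) $ i $ j = X $ i $ j"
      by (simp add: matrix_matrix_mult_def)
    with X j show False by simp
  qed
  have closed: "u ** v \<in> ?U" if "v \<in> ?U" for v
  proof -
    have "(u - mat 1) ** (v - mat 1) + (u - mat 1) + (v - mat 1) \<in> pattern_space J"
      using u that unfolding pattern_group_def
      by (intro pattern_space_add matrix_mult_pattern_space[OF J(2)]) auto
    also have "(u - mat 1) ** (v - mat 1) + (u - mat 1) + (v - mat 1) = u ** v - mat 1"
      by (simp add: matrix_diff_ldistrib matrix_diff_rdistrib)
    finally show ?thesis by (simp add: pattern_group_def)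
  qed
  have "inj_on ((**) u) ?U"
  proof (rule inj_onI)
    fix v w :: "(('a, 'n) vec, 'n) vec" assume "u ** v = u ** w"
    then have "u ** (v - w) = 0" by (simp add: matrix_diff_ldistrib)
    then show "v = w" using zero[of "v - w"] by simp
  qed
  then have "(**) u ` ?U = ?U"
    using closed by (intro endo_inj_surj) auto
  moreover have "mat 1 \<in> ?U"
    by (simp add: pattern_group_def pattern_space_def)
  ultimately obtain v where v: "v \<in> ?U" "u ** v = mat 1"
    by (force simp: image_iff)
  have "v ** u = mat 1" using v(2) by (simp add: matrix_left_right_inverse)
  then have ex: "\<exists>v. u ** v = mat 1 \<and> v ** u = mat 1" using v by blast
  show 1: "u ** matrix_inv u = mat 1" and "matrix_inv u ** u = mat 1"
    using someI_ex[OF ex] unfolding matrix_inv_def by auto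
  have "matrix_inv u = v"
    using 1 v(2) \<open>v ** u = mat 1\<close> by (metis matrix_mul_assoc matrix_mul_lid matrix_mul_rid)
  with v(1) show "matrix_inv u \<in> ?U" by simp
qed

lemma dot_mchar_of:
  fixes A :: "'a::{field,finite} ^ 'n::{finite,linorder} ^ 'n::{finite,linorder}"
  assumes J: "J \<subseteq> positive_roots" "trans J"
    and A: "A \<in> pattern_space J" and u: "u \<in> pattern_group J" and v: "v \<in> pattern_group J"
  shows "dot J u (mchar_of \<theta> J A) v =
    mchar_of \<theta> J (pattern_proj J (transpose (matrix_inv u) ** A ** transpose (matrix_inv v)))"
proof -
  have "matrix_inv u ** B ** matrix_inv v \<in> pattern_space J"
    if B: "B \<in> pattern_space J" for B
  proof -
    note m = matrix_mult_pattern_space[OF J(2)]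
    have inv: "matrix_inv u - mat 1 \<in> pattern_space J" "matrix_inv v - mat 1 \<in> pattern_space J"
      using matrix_inv_pattern_group(1)[OF J] u v by (auto simp: pattern_group_def)
    have "(matrix_inv u - mat 1) ** B + B \<in> pattern_space J"
      by (intro pattern_space_add m inv B)
    then have uB: "matrix_inv u ** B \<in> pattern_space J"
      by (simp add: matrix_diff_rdistrib)
    have "(matrix_inv u ** B) ** (matrix_inv v - mat 1) + matrix_inv u ** B \<in> pattern_space J"
      by (intro pattern_space_add m inv uB)
    then show ?thesis
      by (simp add: matrix_diff_ldistrib)
  qed
  then show ?thesis
    unfolding dot_def mchar_of_def
    by (intro restrict_ext) (simp add: star_pattern_proj[OF A])
qed


subsection \<open>The bimodule on the span of the characters\<close>

text \<open>
  An element \<open>\<Sum>\<^sub>\<psi> f\<^sub>\<psi> \<psi>\<close> of the vector space with basis \<open>dual J\<close> is represented by its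
  coefficient function \<open>f\<close>. Recall that \<open>dual J\<close> is a finite set, so that the sums below make sense.
\<close>

type_synonym ('a, 'n) mvec = "('a, 'n) mchar \<Rightarrow> complex"

definition basis_vec :: "('a, 'n) mchar \<Rightarrow> ('a, 'n) mvec"
  where "basis_vec \<psi> = (\<lambda>\<phi>. if \<phi> = \<psi> then 1 else 0)"

definition orbit_module :: "('a, 'n) mchar set \<Rightarrow> ('a, 'n) mvec set"
  where "orbit_module X = {f. \<forall>\<psi>. f \<psi> \<noteq> 0 \<longrightarrow> \<psi> \<in> X}"

text \<open>
  The monomial actions: for \<open>\<psi> = [A]\<close> the coefficient \<open>\<theta>(A\<^sup>*(u\<^sup>-\<^sup>1 - E))\<close> is \<open>\<psi> (u\<^sup>-\<^sup>1 - E)\<close>.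
\<close>

definition left_mult ::
    "('n::finite \<times> 'n) set \<Rightarrow> 'a::field ^ 'n ^ 'n \<Rightarrow> ('a, 'n) mvec \<Rightarrow> ('a, 'n) mvec"
  where "left_mult J u f =
    (\<lambda>\<phi>. \<Sum>\<psi>\<in>dual J. f \<psi> * (\<psi> (matrix_inv u - mat 1) * basis_vec (dot J u \<psi> (mat 1)) \<phi>))"

definition right_mult ::
    "('n::finite \<times> 'n) set \<Rightarrow> 'a::field ^ 'n ^ 'n \<Rightarrow> ('a, 'n) mvec \<Rightarrow> ('a, 'n) mvec"
  where "right_mult J u f =
    (\<lambda>\<phi>. \<Sum>\<psi>\<in>dual J. f \<psi> * (\<psi> (matrix_inv u - mat 1) * basis_vec (dot J (mat 1) \<psi> u) \<phi>))"

text \<open>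
  Elements \<open>\<Sum>\<^sub>u x\<^sub>u u\<close> of the group algebra \<open>\<complex>U\<^sub>J\<close> are likewise coefficient functions; the
  actions of the group are extended linearly to the group algebra.
\<close>

definition group_algebra :: "('n::finite \<times> 'n) set \<Rightarrow> ('a::field ^ 'n ^ 'n \<Rightarrow> complex) set"
  where "group_algebra J = {x. \<forall>u. x u \<noteq> 0 \<longrightarrow> u \<in> pattern_group J}"

definition left_act ::
    "('n::finite \<times> 'n) set \<Rightarrow> ('a::field ^ 'n ^ 'n \<Rightarrow> complex) \<Rightarrow> ('a, 'n) mvec \<Rightarrow> ('a, 'n) mvec"
  where "left_act J x f = (\<lambda>\<phi>. \<Sum>u\<in>pattern_group J. x u * left_mult J u f \<phi>)"

definition right_act ::
    "('n::finite \<times> 'n) set \<Rightarrow> ('a::field ^ 'n ^ 'n \<Rightarrow> complex) \<Rightarrow> ('a, 'n) mvec \<Rightarrow> ('a, 'n) mvec"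
  where "right_act J x f = (\<lambda>\<phi>. \<Sum>u\<in>pattern_group J. x u * right_mult J u f \<phi>)"

text \<open>
  Isomorphism of two modules \<open>M\<close>, \<open>N\<close> over the ring of scalars \<open>R\<close>, where \<open>act x\<close> is
  (left or right) multiplication by the scalar \<open>x\<close>. For the group algebra, \<open>\<complex>\<close>-linearity
  is included since \<open>R\<close> contains the multiples of the unit element.
\<close>

definition module_isomorphic ::
    "'r set \<Rightarrow> ('r \<Rightarrow> ('b \<Rightarrow> complex) \<Rightarrow> ('b \<Rightarrow> complex)) \<Rightarrow>
      ('b \<Rightarrow> complex) set \<Rightarrow> ('b \<Rightarrow> complex) set \<Rightarrow> bool"
  where "module_isomorphic R act M N \<longleftrightarrow>
    (\<exists>F. bij_betw F M N \<and>
      (\<forall>f\<in>M. \<forall>g\<in>M. F (\<lambda>\<phi>. f \<phi> + g \<phi>) = (\<lambda>\<phi>. F f \<phi> + F g \<phi>)) \<and>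
      (\<forall>x\<in>R. \<forall>f\<in>M. F (act x f) = act x (F f)))"

definition left_isomorphic ::
    "('n::finite \<times> 'n) set \<Rightarrow> ('a::field, 'n) mvec set \<Rightarrow> ('a, 'n) mvec set \<Rightarrow> bool"
  where "left_isomorphic J M N \<longleftrightarrow> module_isomorphic (group_algebra J) (left_act J) M N"

definition right_isomorphic ::
    "('n::finite \<times> 'n) set \<Rightarrow> ('a::field, 'n) mvec set \<Rightarrow> ('a, 'n) mvec set \<Rightarrow> bool"
  where "right_isomorphic J M N \<longleftrightarrow> module_isomorphic (group_algebra J) (right_act J) M N"


subsection \<open>Characters afforded by orbits\<close>

text \<open>The trace of the group element \<open>u\<close> on the span of \<open>X\<close> is computed in the basis \<open>X\<close>.\<close>

definition left_character ::
    "('n::finite \<times> 'n) set \<Rightarrow> ('a::field, 'n) mchar set \<Rightarrow> 'a ^ 'n ^ 'n \<Rightarrow> complex"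
  where "left_character J X u = (\<Sum>\<psi>\<in>X. left_mult J u (basis_vec \<psi>) \<psi>)"

definition right_character ::
    "('n::finite \<times> 'n) set \<Rightarrow> ('a::field, 'n) mchar set \<Rightarrow> 'a ^ 'n ^ 'n \<Rightarrow> complex"
  where "right_character J X u = (\<Sum>\<psi>\<in>X. right_mult J u (basis_vec \<psi>) \<psi>)"

definition character_inner ::
    "('n::finite \<times> 'n) set \<Rightarrow> ('a::field ^ 'n ^ 'n \<Rightarrow> complex) \<Rightarrow> ('a ^ 'n ^ 'n \<Rightarrow> complex) \<Rightarrow> complex"
  where "character_inner J \<alpha> \<beta> =
    (\<Sum>u\<in>pattern_group J. \<alpha> u * cnj (\<beta> u)) / of_nat (card (pattern_group J :: ('a ^ 'n ^ 'n) set))"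

end

theory Submission
  imports Defs
begin

text \<open>
  Both statements come down to one question: for which characters \<open>\<psi>\<close>, \<open>\<phi>\<close> of \<open>V\<^sub>J\<close> do the
  scalars by which the common stabilizer acts on \<open>\<psi>\<close> and on \<open>\<phi>\<close> agree?

  Under the left dot action \<open>u\<close> fixes \<open>\<psi>\<close> exactly when \<open>C = u\<^sup>-\<^sup>1 - E\<close> lies in the additive group
  \<open>L\<^sub>\<psi> = {C \<in> V\<^sub>J. \<psi>(C B) = 1 for all B \<in> V\<^sub>J}\<close>, and then \<open>u\<close> multiplies the basis vector
  \<open>\<psi>\<close> by \<open>\<psi>(C)\<close>. So the scalars are the values of additive characters on the additive group
  \<open>L\<^sub>\<psi> \<inter> L\<^sub>\<phi>\<close>. This group is the common kernel of the characters \<open>C \<mapsto> \<psi>(C B) \<phi>(C B')\<^sup>-\<^sup>1\<close>,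
  which form a group. By duality of finite abelian groups, \<open>\<psi>\<close> and \<open>\<phi>\<close> agree on
  \<open>L\<^sub>\<psi> \<inter> L\<^sub>\<phi>\<close> only if \<open>\<psi>(C (E + B)) = \<phi>(C (E + B'))\<close> for some \<open>B, B' \<in> V\<^sub>J\<close> and all \<open>C\<close>,
  and this says that \<open>\<psi>\<close> and \<open>\<phi>\<close> lie in the same orbit under the action from the right. The
  quantitative form is \<open>sum_common_annihilator_eq_0\<close>: if there are no such \<open>B\<close>, \<open>B'\<close>, then \<open>\<psi>\<close> and
  \<open>\<phi>\<close> are orthogonal on \<open>L\<^sub>\<psi> \<inter> L\<^sub>\<phi>\<close>.

  Orthogonality of the characters of distinct biorbits is then immediate, since their inner
  product is a sum over pairs \<open>(\<psi>, \<phi>)\<close> of such sums. An isomorphism of left orbit modules sends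
  the basis vector \<open>\<psi>\<close> to a vector in which some basis vector \<open>\<phi>\<close> of the other orbit occurs;
  the common stabilizer acts on both by the same scalars, so the biorbits agree
  (\<open>biorbit_eq_of_left_isomorphic\<close>). Conversely, right multiplication by a group element is an
  isomorphism from a left orbit module to that of the translated orbit, and symmetrically for
  right orbit modules (\<open>isomorphic_of_dot\<close>).
\<close>

section \<open>Characters of finite abelian groups\<close>

locale finite_additive_subgroup =
  fixes V :: "'v::ab_group_add set"
  assumes finite: "finite V"
    and zero: "0 \<in> V"
    and add: "x \<in> V \<Longrightarrow> y \<in> V \<Longrightarrow> x + y \<in> V"
    and uminus: "x \<in> V \<Longrightarrow> - x \<in> V"
begin

lemma translation_bij: "x \<in> V \<Longrightarrow> bij_betw ((+) x) V V"
  by (rule bij_betwI[where g = "\<lambda>y. - x + y"]) (auto simp del: add_uminus_conv_diff uminus_add_conv_diff intro: add uminus)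

lemma sum_nontrivial_eq_0:
  fixes h :: "'v \<Rightarrow> complex"
  assumes mult: "\<And>x y. x \<in> V \<Longrightarrow> y \<in> V \<Longrightarrow> h (x + y) = h x * h y"
    and a: "a \<in> V" "h a \<noteq> 1"
  shows "(\<Sum>x\<in>V. h x) = 0"
proof -
  have "(\<Sum>x\<in>V. h x) = (\<Sum>x\<in>V. h (a + x))"
    by (rule sum.reindex_bij_betw[OF translation_bij[OF a(1)], symmetric])
  also have "\<dots> = h a * (\<Sum>x\<in>V. h x)"
    by (simp add: mult a(1) sum_distrib_left)
  finally show ?thesis using a(2) by simp
qed

context
  fixes \<psi> :: "'v \<Rightarrow> complex"
  assumes \<psi>: "\<psi> \<in> linear_characters V"
begin

lemma character_add: "x \<in> V \<Longrightarrow> y \<in> V \<Longrightarrow> \<psi> (x + y) = \<psi> x * \<psi> y"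
  using \<psi> by (auto simp: linear_characters_def)

lemma character_nonzero: "x \<in> V \<Longrightarrow> \<psi> x \<noteq> 0"
  using \<psi> by (auto simp: linear_characters_def)

lemma character_zero: "\<psi> 0 = 1"
  using character_add[OF zero zero] character_nonzero[OF zero] by simp

lemma character_power_card:
  assumes x: "x \<in> V"
  shows "\<psi> x ^ card V = 1"
proof -
  have "(\<Prod>y\<in>V. \<psi> y) = (\<Prod>y\<in>V. \<psi> (x + y))"
    by (rule prod.reindex_bij_betw[OF translation_bij[OF x], symmetric])
  also have "\<dots> = \<psi> x ^ card V * (\<Prod>y\<in>V. \<psi> y)"
    by (simp add: character_add x prod.distrib)
  finally show ?thesis
    using character_nonzero finite by simp
qed

lemma character_cnj:
  assumes x: "x \<in> V"
  shows "\<psi> x * cnj (\<psi> x) = 1"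
proof -
  have "card V \<noteq> 0" using zero finite by auto
  then have "norm (\<psi> x) = 1"
    using power_eq_1_iff[OF character_power_card[OF x]] by simp
  then show ?thesis by (simp add: complex_norm_square[symmetric])
qed

end

text \<open>The values are roots of unity of order dividing \<open>card V\<close>, so there are only finitely many.\<close>

lemma finite_linear_characters: "finite (linear_characters V)"
proof (rule finite_subset)
  have "card V > 0" using zero finite by (auto simp: card_gt_0_iff)
  then show "finite (V \<rightarrow>\<^sub>E {z::complex. z ^ card V = 1})"
    by (intro finite_PiE finite finite_roots_unity) simp
  show "linear_characters V \<subseteq> (V \<rightarrow>\<^sub>E {z. z ^ card V = 1})"
    using character_power_card by (auto simp: linear_characters_def PiE_def)
qed

text \<open>
  Summing \<open>\<psi>(m C B)\<close> over \<open>B\<close> and \<open>cnj \<phi>(m C B')\<close> over \<open>B'\<close> detects whether \<open>C\<close> lies in the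
  common annihilator. Inserting this detector turns the sum over the annihilator into a double sum
  over \<open>B\<close>, \<open>B'\<close> of complete sums of the characters \<open>C \<mapsto> \<psi>(C + m C B) cnj \<phi>(C + m C B')\<close> of
  \<open>V\<close>; these are all nontrivial by hypothesis, so every one of the sums is zero. The biadditive
  map \<open>m\<close> is left abstract to cover both the matrix product and its opposite.
\<close>

lemma sum_common_annihilator_eq_0:
  fixes m :: "'v \<Rightarrow> 'v \<Rightarrow> 'v"
  assumes \<psi>: "\<psi> \<in> linear_characters V" and \<phi>: "\<phi> \<in> linear_characters V"
    and m: "\<And>x y. x \<in> V \<Longrightarrow> y \<in> V \<Longrightarrow> m x y \<in> V"
    and ml: "\<And>x y z. m (x + y) z = m x z + m y z"
    and mr: "\<And>x y z. m x (y + z) = m x y + m x z"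
    and separated: "\<And>B B'. B \<in> V \<Longrightarrow> B' \<in> V \<Longrightarrow> \<exists>C\<in>V. \<psi> (C + m C B) \<noteq> \<phi> (C + m C B')"
  shows "(\<Sum>C\<in>{C\<in>V. (\<forall>B\<in>V. \<psi> (m C B) = 1) \<and> (\<forall>B\<in>V. \<phi> (m C B) = 1)}. \<psi> C * cnj (\<phi> C)) = 0"
    (is "sum _ ?L = 0")
proof -
  have indicator: "(\<Sum>B\<in>V. \<eta> (m C B)) = (if \<forall>B\<in>V. \<eta> (m C B) = 1 then of_nat (card V) else 0)"
    if \<eta>: "\<eta> \<in> linear_characters V" and C: "C \<in> V" for \<eta> C
    using sum_nontrivial_eq_0[of "\<lambda>B. \<eta> (m C B)"]
    by (auto simp: mr character_add[OF \<eta>] m C)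
  have vanish: "(\<Sum>C\<in>V. \<psi> (C + m C B) * cnj (\<phi> (C + m C B'))) = 0"
    if B: "B \<in> V" "B' \<in> V" for B B'
  proof -
    obtain C where C: "C \<in> V" "\<psi> (C + m C B) \<noteq> \<phi> (C + m C B')"
      using separated[OF B] by blast
    have c: "\<phi> (C + m C B') * cnj (\<phi> (C + m C B')) = 1"
      by (intro character_cnj[OF \<phi>] add C m B)
    have ne: "\<psi> (C + m C B) * cnj (\<phi> (C + m C B')) \<noteq> 1"
    proof
      assume "\<psi> (C + m C B) * cnj (\<phi> (C + m C B')) = 1"
      with c have "\<psi> (C + m C B) = \<phi> (C + m C B')"
        by (metis mult_cancel_right mult_zero_right zero_neq_one)
      with C show False by simp
    qed
    have *: "\<eta> (x + y + m (x + y) D) = \<eta> (x + m x D) * \<eta> (y + m y D)"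
      if "\<eta> \<in> linear_characters V" "x \<in> V" "y \<in> V" "D \<in> V" for \<eta> x y D
    proof -
      have "x + y + m (x + y) D = (x + m x D) + (y + m y D)" by (simp add: ml algebra_simps)
      then show ?thesis using that by (simp only:) (intro character_add add m)
    qed
    show ?thesis
      by (rule sum_nontrivial_eq_0[where h = "\<lambda>C. \<psi> (C + m C B) * cnj (\<phi> (C + m C B'))" and a = C])
        (simp_all add: *[OF \<psi>] *[OF \<phi>] B C(1) ne)
  qed
  have "0 = (\<Sum>B\<in>V. \<Sum>B'\<in>V. \<Sum>C\<in>V. \<psi> (C + m C B) * cnj (\<phi> (C + m C B')))"
    by (simp add: vanish)
  also have "\<dots> = (\<Sum>B\<in>V. \<Sum>C\<in>V. \<Sum>B'\<in>V. \<psi> (C + m C B) * cnj (\<phi> (C + m C B')))"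
    by (rule sum.cong[OF refl], rule sum.swap)
  also have "\<dots> = (\<Sum>C\<in>V. \<Sum>B\<in>V. \<Sum>B'\<in>V. \<psi> (C + m C B) * cnj (\<phi> (C + m C B')))"
    by (rule sum.swap)
  also have "\<dots> = (\<Sum>C\<in>V. \<psi> C * cnj (\<phi> C) * ((\<Sum>B\<in>V. \<psi> (m C B)) * cnj (\<Sum>B'\<in>V. \<phi> (m C B'))))"
    unfolding cnj_sum sum_product unfolding sum_distrib_left
    by (intro sum.cong refl) (simp add: character_add[OF \<psi>] character_add[OF \<phi>] m)
  also have "\<dots> = (\<Sum>C\<in>V. if C \<in> ?L then of_nat (card V) ^ 2 * (\<psi> C * cnj (\<phi> C)) else 0)"
    by (intro sum.cong refl) (auto simp: indicator[OF \<psi>] indicator[OF \<phi>] power2_eq_square)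
  also have "\<dots> = of_nat (card V) ^ 2 * (\<Sum>C\<in>?L. \<psi> C * cnj (\<phi> C))"
    by (simp add: sum_distrib_left sum.If_cases[OF finite] Int_def)
  finally show ?thesis
    using zero finite by auto
qed

end

section \<open>Monomial maps\<close>

text \<open>
  The linear map that sends the basis vector \<open>x\<close> to \<open>c x\<close> times the basis vector \<open>\<sigma> x\<close>. Left and
  right multiplication by a group element are both of this form, with the same weights \<open>c\<close>.
\<close>

definition monomial_map ::
    "'x set \<Rightarrow> ('x \<Rightarrow> complex) \<Rightarrow> ('x \<Rightarrow> 'x) \<Rightarrow> ('x \<Rightarrow> complex) \<Rightarrow> 'x \<Rightarrow> complex"
  where "monomial_map X c \<sigma> f = (\<lambda>y. \<Sum>x\<in>X. f x * (c x * (if y = \<sigma> x then 1 else 0)))"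

lemma monomial_map_image:
  assumes "finite X" "inj_on \<sigma> X" "x \<in> X"
  shows "monomial_map X c \<sigma> f (\<sigma> x) = c x * f x"
proof -
  have "monomial_map X c \<sigma> f (\<sigma> x) = (\<Sum>z\<in>X. if x = z then f z * c z else 0)"
    unfolding monomial_map_def
    by (rule sum.cong) (use assms in \<open>auto simp: inj_on_def\<close>)
  then show ?thesis using assms by simp
qed

lemma monomial_map_not_image: "y \<notin> \<sigma> ` X \<Longrightarrow> monomial_map X c \<sigma> f y = 0"
  unfolding monomial_map_def by (rule sum.neutral) auto

lemma monomial_map_add:
  "monomial_map X c \<sigma> (\<lambda>x. f x + g x) = (\<lambda>y. monomial_map X c \<sigma> f y + monomial_map X c \<sigma> g y)"
  by (simp add: monomial_map_def sum.distrib algebra_simps)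

lemma monomial_map_linear_combination:
  "monomial_map X c \<sigma> (\<lambda>x. \<Sum>u\<in>U. a u * f u x) = (\<lambda>y. \<Sum>u\<in>U. a u * monomial_map X c \<sigma> (f u) y)"
proof
  fix y
  have "monomial_map X c \<sigma> (\<lambda>x. \<Sum>u\<in>U. a u * f u x) y
      = (\<Sum>x\<in>X. \<Sum>u\<in>U. a u * f u x * (c x * (if y = \<sigma> x then 1 else 0)))"
    unfolding monomial_map_def by (simp only: sum_distrib_right)
  also have "\<dots> = (\<Sum>u\<in>U. \<Sum>x\<in>X. a u * f u x * (c x * (if y = \<sigma> x then 1 else 0)))"
    by (rule sum.swap)
  also have "\<dots> = (\<Sum>u\<in>U. a u * monomial_map X c \<sigma> (f u) y)"
    unfolding monomial_map_def by (simp add: sum_distrib_left mult.assoc)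
  finally show "monomial_map X c \<sigma> (\<lambda>x. \<Sum>u\<in>U. a u * f u x) y = \<dots>" .
qed

text \<open>
  Both composites are monomial with underlying map \<open>\<sigma> \<circ> \<tau> = \<tau> \<circ> \<sigma>\<close>, and \<open>cocycle\<close> equates
  their weights.
\<close>

lemma monomial_map_commute:
  assumes X: "finite X" and \<sigma>: "bij_betw \<sigma> X X" and \<tau>: "bij_betw \<tau> X X"
    and comm: "\<And>x. x \<in> X \<Longrightarrow> \<sigma> (\<tau> x) = \<tau> (\<sigma> x)"
    and cocycle: "\<And>x. x \<in> X \<Longrightarrow> c (\<tau> x) * d x = d (\<sigma> x) * c x"
  shows "monomial_map X c \<sigma> (monomial_map X d \<tau> f) = monomial_map X d \<tau> (monomial_map X c \<sigma> f)"
proof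
  fix y
  note s = bij_betw_imp_inj_on[OF \<sigma>] bij_betw_imp_surj_on[OF \<sigma>] bij_betw_apply[OF \<sigma>]
  note t = bij_betw_imp_inj_on[OF \<tau>] bij_betw_imp_surj_on[OF \<tau>] bij_betw_apply[OF \<tau>]
  show "monomial_map X c \<sigma> (monomial_map X d \<tau> f) y = monomial_map X d \<tau> (monomial_map X c \<sigma> f) y"
  proof (cases "y \<in> X")
    case True
    then obtain x where x: "x \<in> X" "y = \<sigma> (\<tau> x)"
      using s(2) t(2) by (metis imageE)
    have "monomial_map X c \<sigma> (monomial_map X d \<tau> f) y = c (\<tau> x) * d x * f x"
      unfolding x(2) by (simp add: monomial_map_image X s t x)
    moreover have "monomial_map X d \<tau> (monomial_map X c \<sigma> f) y = d (\<sigma> x) * c x * f x"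
      unfolding x(2) comm[OF x(1)] by (simp add: monomial_map_image X s t x)
    ultimately show ?thesis by (simp add: cocycle x)
  next
    case False
    then show ?thesis by (simp add: monomial_map_not_image s t)
  qed
qed

text \<open>The inverse map moves coefficients back along \<open>\<sigma>\<close> and divides by the weights.\<close>

lemma monomial_map_orbit_module:
  fixes X Y :: "('a, 'n::finite) mchar set"
  assumes X: "finite X" and \<sigma>: "inj_on \<sigma> X" and c: "\<And>x. x \<in> X \<Longrightarrow> c x \<noteq> 0" and Y: "Y \<subseteq> X"
  shows "bij_betw (monomial_map X c \<sigma>) (orbit_module Y) (orbit_module (\<sigma> ` Y))"
proof (rule bij_betwI[where g = "\<lambda>g x. if x \<in> Y then g (\<sigma> x) / c x else 0"])
  show "monomial_map X c \<sigma> \<in> orbit_module Y \<rightarrow> orbit_module (\<sigma> ` Y)"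
  proof
    fix f :: "('a, 'n) mvec" assume f: "f \<in> orbit_module Y"
    show "monomial_map X c \<sigma> f \<in> orbit_module (\<sigma> ` Y)"
      unfolding orbit_module_def
    proof (intro CollectI allI impI)
      fix y assume y: "monomial_map X c \<sigma> f y \<noteq> 0"
      then obtain x where x: "x \<in> X" "y = \<sigma> x"
        using monomial_map_not_image by (metis imageE)
      then have "f x \<noteq> 0" using y by (auto simp: monomial_map_image X \<sigma>)
      then show "y \<in> \<sigma> ` Y" using f x by (auto simp: orbit_module_def)
    qed
  qed
  show "(\<lambda>g x. if x \<in> Y then g (\<sigma> x) / c x else 0) \<in> orbit_module (\<sigma> ` Y) \<rightarrow> orbit_module Y"
    by (auto simp: orbit_module_def split: if_splits)
  show "(\<lambda>x. if x \<in> Y then monomial_map X c \<sigma> f (\<sigma> x) / c x else 0) = f"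
    if "f \<in> orbit_module Y" for f
    using that subsetD[OF Y] c by (fastforce simp: orbit_module_def monomial_map_image[OF X \<sigma>])
  show "monomial_map X c \<sigma> (\<lambda>x. if x \<in> Y then g (\<sigma> x) / c x else 0) = g"
    if g: "g \<in> orbit_module (\<sigma> ` Y)" for g
  proof
    fix y
    show "monomial_map X c \<sigma> (\<lambda>x. if x \<in> Y then g (\<sigma> x) / c x else 0) y = g y"
    proof (cases "y \<in> \<sigma> ` X")
      case True
      then obtain x where x: "x \<in> X" "y = \<sigma> x" by blast
      have "\<sigma> x \<in> \<sigma> ` Y \<longleftrightarrow> x \<in> Y" using x Y \<sigma> by (meson inj_on_image_mem_iff)
      then show ?thesis
        unfolding x(2) using g c x by (auto simp: monomial_map_image[OF X \<sigma>] orbit_module_def)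
    next
      case False
      then show ?thesis using g Y by (auto simp: monomial_map_not_image orbit_module_def)
    qed
  qed
qed

section \<open>The dot action of a pattern group\<close>

type_synonym ('a, 'n) square_matrix = "'a ^ 'n ^ 'n"

context
  fixes J :: "('n::{finite,linorder} \<times> 'n) set"
  assumes J: "J \<subseteq> positive_roots" "trans J"
begin

lemma pattern_space_subgroup:
  "finite_additive_subgroup (pattern_space J :: ('a::{field,finite}, 'n) square_matrix set)"
  by unfold_locales (auto simp: pattern_space_def, force)

interpretation V: finite_additive_subgroup "pattern_space J :: ('a::{field,finite}, 'n) square_matrix set"
  by (rule pattern_space_subgroup)

lemma pattern_group_iff: "u \<in> pattern_group J \<longleftrightarrow> u - mat 1 \<in> pattern_space J"
  by (simp add: pattern_group_def)

lemma pattern_group_one: "mat 1 \<in> pattern_group J"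
  by (simp add: pattern_group_def pattern_space_def)

lemma pattern_group_mult_pattern_space:
  fixes u B :: "('a::{field,finite}, 'n) square_matrix"
  assumes "u \<in> pattern_group J" "B \<in> pattern_space J"
  shows "u ** B \<in> pattern_space J" "B ** u \<in> pattern_space J"
proof -
  have "(u - mat 1) ** B + B \<in> pattern_space J" "B ** (u - mat 1) + B \<in> pattern_space J"
    using assms by (auto simp: pattern_group_iff intro!: V.add matrix_mult_pattern_space J)
  then show "u ** B \<in> pattern_space J" "B ** u \<in> pattern_space J"
    by (simp_all add: matrix_diff_rdistrib matrix_diff_ldistrib)
qed

lemma pattern_group_mult:
  fixes u v :: "('a::{field,finite}, 'n) square_matrix"
  assumes "u \<in> pattern_group J" "v \<in> pattern_group J"
  shows "u ** v \<in> pattern_group J"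
proof -
  have "u ** (v - mat 1) + (u - mat 1) \<in> pattern_space J"
    using assms by (intro V.add pattern_group_mult_pattern_space) (auto simp: pattern_group_iff)
  then show ?thesis by (simp add: pattern_group_iff matrix_diff_ldistrib)
qed

lemma matrix_add_rdistrib: "(A + B) ** C = A ** C + B ** (C :: ('a::{field,finite}, 'n) square_matrix)"
  by (simp add: matrix_matrix_mult_def vec_eq_iff distrib_right sum.distrib)

lemma inverse_unique:
  fixes u w :: "('a::{field,finite}, 'n) square_matrix"
  assumes "u \<in> pattern_group J" "u ** w = mat 1"
  shows "matrix_inv u = w"
  using matrix_inv_pattern_group(3)[OF J assms(1)] assms(2)
  by (metis matrix_mul_assoc matrix_mul_lid matrix_mul_rid)

lemma inverse_mult:
  fixes u v :: "('a::{field,finite}, 'n) square_matrix"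
  assumes "u \<in> pattern_group J" "v \<in> pattern_group J"
  shows "matrix_inv (u ** v) = matrix_inv v ** matrix_inv u"
proof (rule inverse_unique[OF pattern_group_mult[OF assms]])
  have "u ** v ** (matrix_inv v ** matrix_inv u) = u ** (v ** matrix_inv v) ** matrix_inv u"
    by (simp only: matrix_mul_assoc)
  then show "u ** v ** (matrix_inv v ** matrix_inv u) = mat 1"
    by (simp add: matrix_inv_pattern_group(2)[OF J] assms)
qed

lemma inverse_inverse:
  fixes u :: "('a::{field,finite}, 'n) square_matrix"
  assumes "u \<in> pattern_group J"
  shows "matrix_inv (matrix_inv u) = u"
  using assms matrix_inv_pattern_group[OF J] by (intro inverse_unique)

lemma inverse_one: "matrix_inv (mat 1 :: ('a::{field,finite}, 'n) square_matrix) = mat 1"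
  by (intro inverse_unique pattern_group_one) simp

text \<open>
  Sums over the group become sums over the vector space: \<open>u\<^sup>-\<^sup>1 - E\<close> is the argument at which
  both monomial actions evaluate the characters.
\<close>

lemma inverse_minus_one_bij:
  "bij_betw (\<lambda>u. matrix_inv u - mat 1) (pattern_group J)
     (pattern_space J :: ('a::{field,finite}, 'n) square_matrix set)"
proof (rule bij_betwI[where g = "\<lambda>C. matrix_inv (mat 1 + C)"])
  have 1: "mat 1 + C \<in> pattern_group J" if "C \<in> pattern_space J" for C :: "('a, 'n) square_matrix"
    using that by (simp add: pattern_group_iff)
  show "(\<lambda>u. matrix_inv u - mat 1) \<in> pattern_group J \<rightarrow> (pattern_space J :: ('a, 'n) square_matrix set)"
    using matrix_inv_pattern_group(1)[OF J] by (auto simp: pattern_group_iff)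
  show "(\<lambda>C. matrix_inv (mat 1 + C)) \<in> pattern_space J \<rightarrow> (pattern_group J :: ('a, 'n) square_matrix set)"
    using matrix_inv_pattern_group(1)[OF J] 1 by blast
qed (simp_all add: inverse_inverse pattern_group_iff)

lemma dot_apply:
  "B \<in> pattern_space J \<Longrightarrow> dot J u \<psi> v B = \<psi> (matrix_inv u ** B ** matrix_inv v)"
  by (simp add: dot_def)

lemma dot_argument:
  fixes u v B :: "('a::{field,finite}, 'n) square_matrix"
  assumes "u \<in> pattern_group J" "v \<in> pattern_group J" "B \<in> pattern_space J"
  shows "matrix_inv u ** B ** matrix_inv v \<in> pattern_space J"
  using assms by (intro pattern_group_mult_pattern_space matrix_inv_pattern_group J)

lemma dot_in_dual:
  fixes \<psi> :: "('a::{field,finite}, 'n) mchar"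
  assumes u: "u \<in> pattern_group J" and v: "v \<in> pattern_group J" and \<psi>: "\<psi> \<in> dual J"
  shows "dot J u \<psi> v \<in> dual J"
  unfolding linear_characters_def
  using V.character_nonzero[OF \<psi>] V.character_add[OF \<psi>]
  by (auto simp: dot_apply V.add matrix_add_ldistrib matrix_add_rdistrib dot_argument u v)
    (simp add: dot_def)

lemma dot_dot:
  fixes \<psi> :: "('a::{field,finite}, 'n) mchar"
  assumes "u \<in> pattern_group J" "v \<in> pattern_group J" "u' \<in> pattern_group J" "v' \<in> pattern_group J"
  shows "dot J u (dot J u' \<psi> v') v = dot J (u ** u') \<psi> (v' ** v)"
  unfolding dot_def
  by (intro restrict_ext) (simp add: dot_argument inverse_mult assms matrix_mul_assoc)

lemma dot_one:
  fixes \<psi> :: "('a::{field,finite}, 'n) mchar"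
  assumes "\<psi> \<in> dual J"
  shows "dot J (mat 1) \<psi> (mat 1) = \<psi>"
  using assms by (auto simp: dot_def inverse_one linear_characters_def extensional_restrict)

lemma dot_inverse:
  fixes \<psi> :: "('a::{field,finite}, 'n) mchar"
  assumes "u \<in> pattern_group J" "v \<in> pattern_group J" "\<psi> \<in> dual J"
  shows "dot J (matrix_inv u) (dot J u \<psi> v) (matrix_inv v) = \<psi>"
    and "dot J u (dot J (matrix_inv u) \<psi> (matrix_inv v)) v = \<psi>"
  using assms by (simp_all add: dot_dot matrix_inv_pattern_group[OF J] dot_one)

lemma dot_bij:
  fixes u v :: "('a::{field,finite}, 'n) square_matrix"
  assumes "u \<in> pattern_group J" "v \<in> pattern_group J"
  shows "bij_betw (\<lambda>\<psi>. dot J u \<psi> v) (dual J) (dual J)"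
  by (rule bij_betwI[where g = "\<lambda>\<psi>. dot J (matrix_inv u) \<psi> (matrix_inv v)"])
    (auto simp: dot_in_dual dot_inverse assms matrix_inv_pattern_group(1)[OF J])

text \<open>Passing to \<open>u.\<psi>.v\<close> can only shrink the biorbit, and the translation can be undone.\<close>

lemma biorbit_eq_of_dot_eq:
  fixes \<psi> \<phi> :: "('a::{field,finite}, 'n) mchar"
  assumes u: "u \<in> pattern_group J" "v \<in> pattern_group J"
    and u': "u' \<in> pattern_group J" "v' \<in> pattern_group J"
    and \<psi>: "\<psi> \<in> dual J" and \<phi>: "\<phi> \<in> dual J"
    and eq: "dot J u \<psi> v = dot J u' \<phi> v'"
  shows "biorbit J \<psi> = biorbit J \<phi>"
proof -
  have sub: "biorbit J (dot J u \<psi> v) \<subseteq> biorbit J \<psi>"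
    if "u \<in> pattern_group J" "v \<in> pattern_group J" for u v and \<psi> :: "('a, 'n) mchar"
    using that by (auto simp: biorbit_def dot_dot) (metis pattern_group_mult)
  have "biorbit J (dot J u \<psi> v) = biorbit J \<psi>"
    if u: "u \<in> pattern_group J" "v \<in> pattern_group J" and \<psi>: "\<psi> \<in> dual J" for u v and \<psi> :: "('a, 'n) mchar"
    using sub[OF u, of \<psi>]
      sub[OF matrix_inv_pattern_group(1)[OF J u(1)] matrix_inv_pattern_group(1)[OF J u(2)], of "dot J u \<psi> v"]
    by (simp add: dot_inverse u \<psi>)
  from this[OF u \<psi>] this[OF u' \<phi>] show ?thesis using eq by simp
qed

lemma self_in_biorbit:
  fixes \<psi> :: "('a::{field,finite}, 'n) mchar"
  assumes "\<psi> \<in> dual J"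
  shows "\<psi> \<in> biorbit J \<psi>"
  using dot_one[OF assms] pattern_group_one unfolding biorbit_def by (metis (mono_tags, lifting) mem_Collect_eq)

text \<open>
  The characters \<open>u.\<psi>\<close> and \<open>\<psi>\<close> differ at \<open>B\<close> by the factor \<open>\<psi>((u\<^sup>-\<^sup>1 - E) B)\<close>. So stabilizers,
  a priori subgroups of the nonabelian group \<open>U\<^sub>J\<close>, are translates of additive annihilators.
\<close>

lemma left_stabilizer:
  fixes \<psi> :: "('a::{field,finite}, 'n) mchar"
  assumes u: "u \<in> pattern_group J" and \<psi>: "\<psi> \<in> dual J"
  shows "dot J u \<psi> (mat 1) = \<psi> \<longleftrightarrow> (\<forall>B\<in>pattern_space J. \<psi> ((matrix_inv u - mat 1) ** B) = 1)"
proof -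
  have "dot J u \<psi> (mat 1) B = \<psi> B \<longleftrightarrow> \<psi> ((matrix_inv u - mat 1) ** B) = 1"
    if B: "B \<in> pattern_space J" for B
  proof -
    have 1: "(matrix_inv u - mat 1) ** B \<in> pattern_space J"
      using u B by (intro matrix_mult_pattern_space J)
        (auto simp: pattern_group_iff[symmetric] matrix_inv_pattern_group J)
    have "dot J u \<psi> (mat 1) B = \<psi> ((matrix_inv u - mat 1) ** B + B)"
      by (simp add: dot_apply B inverse_one matrix_diff_rdistrib)
    then show ?thesis
      using V.character_add[OF \<psi> 1 B] V.character_nonzero[OF \<psi> B] by simp
  qed
  moreover have "dot J u \<psi> (mat 1) \<in> extensional (pattern_space J)" "\<psi> \<in> extensional (pattern_space J)"
    using \<psi> by (auto simp: dot_def linear_characters_def)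
  ultimately show ?thesis by (metis extensionalityI)
qed

lemma right_stabilizer:
  fixes \<psi> :: "('a::{field,finite}, 'n) mchar"
  assumes u: "u \<in> pattern_group J" and \<psi>: "\<psi> \<in> dual J"
  shows "dot J (mat 1) \<psi> u = \<psi> \<longleftrightarrow> (\<forall>B\<in>pattern_space J. \<psi> (B ** (matrix_inv u - mat 1)) = 1)"
proof -
  have "dot J (mat 1) \<psi> u B = \<psi> B \<longleftrightarrow> \<psi> (B ** (matrix_inv u - mat 1)) = 1"
    if B: "B \<in> pattern_space J" for B
  proof -
    have 1: "B ** (matrix_inv u - mat 1) \<in> pattern_space J"
      using u B by (intro matrix_mult_pattern_space J)
        (auto simp: pattern_group_iff[symmetric] matrix_inv_pattern_group J)
    have "dot J (mat 1) \<psi> u B = \<psi> (B ** (matrix_inv u - mat 1) + B)"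
      by (simp add: dot_apply B inverse_one matrix_diff_ldistrib)
    then show ?thesis
      using V.character_add[OF \<psi> 1 B] V.character_nonzero[OF \<psi> B] by simp
  qed
  moreover have "dot J (mat 1) \<psi> u \<in> extensional (pattern_space J)" "\<psi> \<in> extensional (pattern_space J)"
    using \<psi> by (auto simp: dot_def linear_characters_def)
  ultimately show ?thesis by (metis extensionalityI)
qed

text \<open>
  Since \<open>C + C B = C (E + B)\<close> with \<open>E + B \<in> U\<^sub>J\<close>, the two shifted characters are \<open>\<psi>.(E + B)\<^sup>-\<^sup>1\<close>
  and \<open>\<phi>.(E + B')\<^sup>-\<^sup>1\<close>.
\<close>

lemma biorbit_eq_of_right_multiple:
  fixes \<psi> \<phi> :: "('a::{field,finite}, 'n) mchar"
  assumes \<psi>: "\<psi> \<in> dual J" and \<phi>: "\<phi> \<in> dual J"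
    and B: "B \<in> pattern_space J" "B' \<in> pattern_space J"
    and eq: "\<And>C. C \<in> pattern_space J \<Longrightarrow> \<psi> (C + C ** B) = \<phi> (C + C ** B')"
  shows "biorbit J \<psi> = biorbit J \<phi>"
proof -
  have U: "mat 1 + B \<in> pattern_group J" "mat 1 + B' \<in> pattern_group J"
    using B by (simp_all add: pattern_group_iff)
  have "dot J (mat 1) \<psi> (matrix_inv (mat 1 + B)) = dot J (mat 1) \<phi> (matrix_inv (mat 1 + B'))"
    unfolding dot_def by (intro restrict_ext) (simp add: inverse_one inverse_inverse U matrix_add_ldistrib eq)
  then show ?thesis
    by (intro biorbit_eq_of_dot_eq[OF _ _ _ _ \<psi> \<phi>])
      (auto intro: pattern_group_one matrix_inv_pattern_group(1)[OF J] U)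
qed

lemma biorbit_eq_of_left_multiple:
  fixes \<psi> \<phi> :: "('a::{field,finite}, 'n) mchar"
  assumes \<psi>: "\<psi> \<in> dual J" and \<phi>: "\<phi> \<in> dual J"
    and B: "B \<in> pattern_space J" "B' \<in> pattern_space J"
    and eq: "\<And>C. C \<in> pattern_space J \<Longrightarrow> \<psi> (C + B ** C) = \<phi> (C + B' ** C)"
  shows "biorbit J \<psi> = biorbit J \<phi>"
proof -
  have U: "mat 1 + B \<in> pattern_group J" "mat 1 + B' \<in> pattern_group J"
    using B by (simp_all add: pattern_group_iff)
  have "dot J (matrix_inv (mat 1 + B)) \<psi> (mat 1) = dot J (matrix_inv (mat 1 + B')) \<phi> (mat 1)"
    unfolding dot_def by (intro restrict_ext) (simp add: inverse_one inverse_inverse U matrix_add_rdistrib eq)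
  then show ?thesis
    by (intro biorbit_eq_of_dot_eq[OF _ _ _ _ \<psi> \<phi>])
      (auto intro: pattern_group_one matrix_inv_pattern_group(1)[OF J] U)
qed

lemma left_annihilator_sum:
  fixes \<psi> \<phi> :: "('a::{field,finite}, 'n) mchar"
  assumes \<psi>: "\<psi> \<in> dual J" and \<phi>: "\<phi> \<in> dual J" and ne: "biorbit J \<psi> \<noteq> biorbit J \<phi>"
  shows "(\<Sum>C\<in>{C\<in>pattern_space J. (\<forall>B\<in>pattern_space J. \<psi> (C ** B) = 1) \<and>
           (\<forall>B\<in>pattern_space J. \<phi> (C ** B) = 1)}. \<psi> C * cnj (\<phi> C)) = 0"
  using ne biorbit_eq_of_right_multiple[OF \<psi> \<phi>]
  by (intro V.sum_common_annihilator_eq_0[OF \<psi> \<phi>])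
    (auto intro: matrix_mult_pattern_space J simp: matrix_add_ldistrib matrix_add_rdistrib)

lemma right_annihilator_sum:
  fixes \<psi> \<phi> :: "('a::{field,finite}, 'n) mchar"
  assumes \<psi>: "\<psi> \<in> dual J" and \<phi>: "\<phi> \<in> dual J" and ne: "biorbit J \<psi> \<noteq> biorbit J \<phi>"
  shows "(\<Sum>C\<in>{C\<in>pattern_space J. (\<forall>B\<in>pattern_space J. \<psi> (B ** C) = 1) \<and>
           (\<forall>B\<in>pattern_space J. \<phi> (B ** C) = 1)}. \<psi> C * cnj (\<phi> C)) = 0"
  using ne biorbit_eq_of_left_multiple[OF \<psi> \<phi>]
  by (intro V.sum_common_annihilator_eq_0[OF \<psi> \<phi>, where m = "\<lambda>C B. B ** C"])
    (auto intro: matrix_mult_pattern_space J simp: matrix_add_ldistrib matrix_add_rdistrib)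

section \<open>Orthogonality\<close>

lemma monomial_map_basis_vec:
  fixes \<psi> :: "('a::{field,finite}, 'n) mchar"
  assumes "\<psi> \<in> dual J"
  shows "monomial_map (dual J) c \<sigma> (basis_vec \<psi>) = (\<lambda>\<phi>. c \<psi> * basis_vec (\<sigma> \<psi>) \<phi>)"
proof
  fix \<phi> :: "('a, 'n) mchar"
  have "monomial_map (dual J) c \<sigma> (basis_vec \<psi>) \<phi>
      = (\<Sum>x\<in>dual J. if x = \<psi> then c \<psi> * basis_vec (\<sigma> \<psi>) \<phi> else 0)"
    unfolding monomial_map_def basis_vec_def by (rule sum.cong) auto
  then show "monomial_map (dual J) c \<sigma> (basis_vec \<psi>) \<phi> = c \<psi> * basis_vec (\<sigma> \<psi>) \<phi>"
    using assms by (simp add: V.finite_linear_characters)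
qed

lemma left_mult_monomial:
  "left_mult J u = monomial_map (dual J) (\<lambda>\<psi>. \<psi> (matrix_inv u - mat 1)) (\<lambda>\<psi>. dot J u \<psi> (mat 1))"
  by (simp add: fun_eq_iff left_mult_def monomial_map_def basis_vec_def)

lemma right_mult_monomial:
  "right_mult J u = monomial_map (dual J) (\<lambda>\<psi>. \<psi> (matrix_inv u - mat 1)) (\<lambda>\<psi>. dot J (mat 1) \<psi> u)"
  by (simp add: fun_eq_iff right_mult_def monomial_map_def basis_vec_def)

text \<open>
  Only basis vectors fixed by \<open>u\<close> contribute to the trace of \<open>u\<close>. After the substitution
  \<open>C = u\<^sup>-\<^sup>1 - E\<close> the inner product is therefore the sum, over \<open>\<psi> \<in> X\<close> and \<open>\<phi> \<in> Y\<close>, of the sums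
  of \<open>\<psi> cnj \<phi>\<close> over common annihilators. The parameters \<open>act\<close> and \<open>m\<close> stand for the left dot
  action with the matrix product, or the right dot action with the opposite product.
\<close>

lemma monomial_characters_orthogonal:
  fixes X Y :: "('a::{field,finite}, 'n) mchar set"
    and act :: "('a, 'n) square_matrix \<Rightarrow> ('a, 'n) mchar \<Rightarrow> ('a, 'n) mchar"
  assumes stab: "\<And>u \<psi>. u \<in> pattern_group J \<Longrightarrow> \<psi> \<in> dual J \<Longrightarrow>
      act u \<psi> = \<psi> \<longleftrightarrow> (\<forall>B\<in>pattern_space J. \<psi> (m (matrix_inv u - mat 1) B) = 1)"
    and sum0: "\<And>\<psi> \<phi>. \<psi> \<in> X \<Longrightarrow> \<phi> \<in> Y \<Longrightarrow>
      (\<Sum>C\<in>{C\<in>pattern_space J. (\<forall>B\<in>pattern_space J. \<psi> (m C B) = 1) \<and>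
           (\<forall>B\<in>pattern_space J. \<phi> (m C B) = 1)}. \<psi> C * cnj (\<phi> C)) = 0"
    and X: "X \<subseteq> dual J" and Y: "Y \<subseteq> dual J"
    and \<alpha>: "\<And>u. \<alpha> u = (\<Sum>\<psi>\<in>X. monomial_map (dual J) (\<lambda>\<psi>. \<psi> (matrix_inv u - mat 1)) (act u) (basis_vec \<psi>) \<psi>)"
    and \<beta>: "\<And>u. \<beta> u = (\<Sum>\<psi>\<in>Y. monomial_map (dual J) (\<lambda>\<psi>. \<psi> (matrix_inv u - mat 1)) (act u) (basis_vec \<psi>) \<psi>)"
  shows "character_inner J \<alpha> \<beta> = 0"
proof -
  (* a \<psi> (u^-1 - E) is the diagonal entry at \<psi> of the matrix of u. *)
  define a where "a \<psi> C = (if \<forall>B\<in>pattern_space J. \<psi> (m C B) = 1 then \<psi> C else 0)"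
    for \<psi> :: "('a, 'n) mchar" and C
  have trace: "(\<Sum>\<psi>\<in>Z. monomial_map (dual J) (\<lambda>\<psi>. \<psi> (matrix_inv u - mat 1)) (act u) (basis_vec \<psi>) \<psi>)
      = (\<Sum>\<psi>\<in>Z. a \<psi> (matrix_inv u - mat 1))"
    if "Z \<subseteq> dual J" "u \<in> pattern_group J" for Z u
  proof (intro sum.cong refl)
    fix \<psi> assume "\<psi> \<in> Z"
    with that have \<psi>: "\<psi> \<in> dual J" by blast
    show "monomial_map (dual J) (\<lambda>\<psi>. \<psi> (matrix_inv u - mat 1)) (act u) (basis_vec \<psi>) \<psi>
        = a \<psi> (matrix_inv u - mat 1)"
      using stab[OF that(2) \<psi>] unfolding monomial_map_basis_vec[OF \<psi>] a_def
      by (auto simp: basis_vec_def)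
  qed
  have "(\<Sum>u\<in>pattern_group J. \<alpha> u * cnj (\<beta> u))
     = (\<Sum>u\<in>pattern_group J. (\<Sum>\<psi>\<in>X. a \<psi> (matrix_inv u - mat 1)) * cnj (\<Sum>\<psi>\<in>Y. a \<psi> (matrix_inv u - mat 1)))"
    by (simp add: \<alpha> \<beta> trace X Y)
  also have "\<dots> = (\<Sum>C\<in>pattern_space J. (\<Sum>\<psi>\<in>X. a \<psi> C) * cnj (\<Sum>\<psi>\<in>Y. a \<psi> C))"
    by (rule sum.reindex_bij_betw[OF inverse_minus_one_bij])
  also have "\<dots> = (\<Sum>C\<in>pattern_space J. \<Sum>\<psi>\<in>X. \<Sum>\<phi>\<in>Y. a \<psi> C * cnj (a \<phi> C))"
    by (simp add: sum_product cnj_sum)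
  also have "\<dots> = (\<Sum>\<psi>\<in>X. \<Sum>C\<in>pattern_space J. \<Sum>\<phi>\<in>Y. a \<psi> C * cnj (a \<phi> C))"
    by (rule sum.swap)
  also have "\<dots> = (\<Sum>\<psi>\<in>X. \<Sum>\<phi>\<in>Y. \<Sum>C\<in>pattern_space J. a \<psi> C * cnj (a \<phi> C))"
    by (rule sum.cong[OF refl], rule sum.swap)
  also have "\<dots> = (\<Sum>\<psi>\<in>X. \<Sum>\<phi>\<in>Y. 0)"
  proof (intro sum.cong refl)
    fix \<psi> \<phi> assume "\<psi> \<in> X" "\<phi> \<in> Y"
    note sum0[OF this]
    moreover have "(\<Sum>C\<in>pattern_space J. a \<psi> C * cnj (a \<phi> C)) =
        (\<Sum>C\<in>{C\<in>pattern_space J. (\<forall>B\<in>pattern_space J. \<psi> (m C B) = 1) \<and>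
           (\<forall>B\<in>pattern_space J. \<phi> (m C B) = 1)}. \<psi> C * cnj (\<phi> C))"
      by (rule sum.mono_neutral_cong_right) (auto simp: a_def)
    ultimately show "(\<Sum>C\<in>pattern_space J. a \<psi> C * cnj (a \<phi> C)) = 0" by simp
  qed
  finally show ?thesis by (simp add: character_inner_def)
qed

lemma biorbit_characters_orthogonal:
  fixes \<psi> \<phi> :: "('a::{field,finite}, 'n) mchar"
  assumes \<psi>: "\<psi> \<in> dual J" and \<phi>: "\<phi> \<in> dual J" and ne: "biorbit J \<psi> \<noteq> biorbit J \<phi>"
  shows "character_inner J (left_character J (biorbit J \<psi>)) (left_character J (biorbit J \<phi>)) = 0"
    and "character_inner J (right_character J (biorbit J \<psi>)) (right_character J (biorbit J \<phi>)) = 0"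
proof -
  have sub: "biorbit J \<eta> \<subseteq> dual J" and eq: "\<eta>' \<in> biorbit J \<eta> \<Longrightarrow> biorbit J \<eta>' = biorbit J \<eta>"
    if "\<eta> \<in> dual J" for \<eta> \<eta>' :: "('a, 'n) mchar"
  proof -
    show sub: "biorbit J \<eta> \<subseteq> dual J" using that by (auto simp: biorbit_def dot_in_dual)
    assume \<eta>': "\<eta>' \<in> biorbit J \<eta>"
    then obtain u v where uv: "u \<in> pattern_group J" "v \<in> pattern_group J" "\<eta>' = dot J u \<eta> v"
      by (auto simp: biorbit_def)
    show "biorbit J \<eta>' = biorbit J \<eta>"
      by (rule biorbit_eq_of_dot_eq[of "mat 1" "mat 1" u v])
        (use uv that sub \<eta>' in \<open>auto simp: dot_one pattern_group_one\<close>)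
  qed
  have ne': "\<psi>' \<in> dual J" "\<phi>' \<in> dual J" "biorbit J \<psi>' \<noteq> biorbit J \<phi>'"
    if "\<psi>' \<in> biorbit J \<psi>" "\<phi>' \<in> biorbit J \<phi>" for \<psi>' \<phi>'
  proof -
    show "\<psi>' \<in> dual J" "\<phi>' \<in> dual J"
      using subsetD[OF sub[OF \<psi>] that(1)] subsetD[OF sub[OF \<phi>] that(2)] .
    show "biorbit J \<psi>' \<noteq> biorbit J \<phi>'"
      unfolding eq[OF \<psi> that(1)] eq[OF \<phi> that(2)] by (rule ne)
  qed
  show "character_inner J (left_character J (biorbit J \<psi>)) (left_character J (biorbit J \<phi>)) = 0"
    by (rule monomial_characters_orthogonal[where m = "(**)" and act = "\<lambda>u \<psi>. dot J u \<psi> (mat 1)",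
          OF left_stabilizer left_annihilator_sum[OF ne'] sub[OF \<psi>] sub[OF \<phi>]])
      (simp_all only: left_character_def left_mult_monomial)
  show "character_inner J (right_character J (biorbit J \<psi>)) (right_character J (biorbit J \<phi>)) = 0"
    by (rule monomial_characters_orthogonal[where m = "\<lambda>C B. B ** C" and act = "\<lambda>u \<psi>. dot J (mat 1) \<psi> u",
          OF right_stabilizer right_annihilator_sum[OF ne'] sub[OF \<psi>] sub[OF \<phi>]])
      (simp_all only: right_character_def right_mult_monomial)
qed

section \<open>Isomorphisms\<close>

text \<open>
  The weights match because \<open>(u\<^sup>-\<^sup>1 - E) v\<^sup>-\<^sup>1 + (v\<^sup>-\<^sup>1 - E)\<close> and \<open>u\<^sup>-\<^sup>1 (v\<^sup>-\<^sup>1 - E) + (u\<^sup>-\<^sup>1 - E)\<close>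
  are both \<open>u\<^sup>-\<^sup>1 v\<^sup>-\<^sup>1 - E\<close>.
\<close>

lemma left_right_commute:
  fixes u v :: "('a::{field,finite}, 'n) square_matrix"
  assumes u: "u \<in> pattern_group J" and v: "v \<in> pattern_group J"
  shows "left_mult J u (right_mult J v f) = right_mult J v (left_mult J u f)"
  unfolding left_mult_monomial right_mult_monomial
proof (rule monomial_map_commute)
  fix \<psi> :: "('a, 'n) mchar" assume \<psi>: "\<psi> \<in> dual J"
  let ?u = "matrix_inv u" and ?v = "matrix_inv v"
  note inv = matrix_inv_pattern_group(1)[OF J u] matrix_inv_pattern_group(1)[OF J v]
  have V: "?u - mat 1 \<in> pattern_space J" "?v - mat 1 \<in> pattern_space J"
    using inv by (simp_all add: pattern_group_iff)
  have "dot J (mat 1) \<psi> v (?u - mat 1) * \<psi> (?v - mat 1) = \<psi> ((?u - mat 1) ** ?v + (?v - mat 1))"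
    by (simp add: dot_apply V inverse_one V.character_add[OF \<psi>] pattern_group_mult_pattern_space inv)
  also have "(?u - mat 1) ** ?v + (?v - mat 1) = ?u ** (?v - mat 1) + (?u - mat 1)"
    by (simp add: matrix_diff_ldistrib matrix_diff_rdistrib)
  also have "\<psi> \<dots> = dot J u \<psi> (mat 1) (?v - mat 1) * \<psi> (?u - mat 1)"
    by (simp add: dot_apply V inverse_one V.character_add[OF \<psi>] pattern_group_mult_pattern_space inv)
  finally show "dot J (mat 1) \<psi> v (?u - mat 1) * \<psi> (?v - mat 1) = \<dots>" .
qed (simp_all add: V.finite_linear_characters dot_bij u v pattern_group_one dot_dot)

lemma module_isomorphic_monomial:
  fixes Y :: "('a::{field,finite}, 'n) mchar set"
  assumes act: "\<And>x f. act x f = (\<lambda>\<phi>. \<Sum>u\<in>pattern_group J. x u * mul u f \<phi>)"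
    and \<sigma>: "inj_on \<sigma> (dual J)" and c: "\<And>\<psi>. \<psi> \<in> dual J \<Longrightarrow> c \<psi> \<noteq> 0" and Y: "Y \<subseteq> dual J"
    and comm: "\<And>u f. u \<in> pattern_group J \<Longrightarrow>
      mul u (monomial_map (dual J) c \<sigma> f) = monomial_map (dual J) c \<sigma> (mul u f)"
  shows "module_isomorphic (group_algebra J :: (('a, 'n) square_matrix \<Rightarrow> complex) set) act
           (orbit_module Y) (orbit_module (\<sigma> ` Y))"
  unfolding module_isomorphic_def
  by (intro exI[of _ "monomial_map (dual J) c \<sigma>"] conjI ballI)
    (simp_all add: monomial_map_orbit_module V.finite_linear_characters \<sigma> c Y monomial_map_add act
      monomial_map_linear_combination comm)

lemma weight_nonzero:
  fixes \<psi> :: "('a::{field,finite}, 'n) mchar"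
  assumes "u \<in> pattern_group J" "\<psi> \<in> dual J"
  shows "\<psi> (matrix_inv u - mat 1) \<noteq> 0"
  using assms matrix_inv_pattern_group(1)[OF J]
  by (intro V.character_nonzero) (auto simp: pattern_group_iff)

lemma translate_image:
  fixes u :: "('a::{field,finite}, 'n) square_matrix"
  assumes u: "u \<in> pattern_group J"
  shows "(\<lambda>w. w ** u) ` pattern_group J = pattern_group J"
    and "(\<lambda>w. u ** w) ` pattern_group J = pattern_group J"
proof -
  note inv = matrix_inv_pattern_group[OF J u]
  have w: "w = (w ** matrix_inv u) ** u" "w = u ** (matrix_inv u ** w)" for w
    by (simp add: matrix_mul_assoc[symmetric] inv) (simp add: matrix_mul_assoc inv)
  show "(\<lambda>w. w ** u) ` pattern_group J = pattern_group J"
    using w(1) pattern_group_mult[OF _ u] pattern_group_mult[OF _ inv(1)] by blast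
  show "(\<lambda>w. u ** w) ` pattern_group J = pattern_group J"
    using w(2) pattern_group_mult[OF u] pattern_group_mult[OF inv(1)] by blast
qed

text \<open>
  The left orbit of \<open>u.\<psi>.v\<close> is the left orbit of \<open>\<psi>.v\<close>, and this is the left orbit of \<open>\<psi>\<close>
  translated by \<open>v\<close> from the right. So the orbit of \<open>u.\<psi>.v\<close> has the form \<open>\<sigma> ` Y\<close> to which
  \<open>module_isomorphic_monomial\<close> applies.
\<close>

lemma left_orbit_dot:
  fixes \<psi> :: "('a::{field,finite}, 'n) mchar"
  assumes uv: "u \<in> pattern_group J" "v \<in> pattern_group J"
  shows "left_orbit J (dot J u \<psi> v) = (\<lambda>\<phi>. dot J (mat 1) \<phi> v) ` left_orbit J \<psi>"
proof -
  have "left_orbit J (dot J u \<psi> v) = (\<lambda>w. dot J w (dot J u \<psi> v) (mat 1)) ` pattern_group J"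
    by (auto simp: left_orbit_def)
  also have "\<dots> = (\<lambda>w. dot J w \<psi> v) ` (\<lambda>w. w ** u) ` pattern_group J"
    unfolding image_image using uv by (intro image_cong refl) (simp add: dot_dot pattern_group_one)
  also have "\<dots> = (\<lambda>w. dot J (mat 1) (dot J w \<psi> (mat 1)) v) ` pattern_group J"
    unfolding translate_image[OF uv(1)]
    using uv by (intro image_cong refl) (simp add: dot_dot pattern_group_one)
  also have "\<dots> = (\<lambda>\<phi>. dot J (mat 1) \<phi> v) ` left_orbit J \<psi>"
    by (auto simp: left_orbit_def)
  finally show ?thesis .
qed

lemma right_orbit_dot:
  fixes \<psi> :: "('a::{field,finite}, 'n) mchar"
  assumes uv: "u \<in> pattern_group J" "v \<in> pattern_group J"
  shows "right_orbit J (dot J u \<psi> v) = (\<lambda>\<phi>. dot J u \<phi> (mat 1)) ` right_orbit J \<psi>"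
proof -
  have "right_orbit J (dot J u \<psi> v) = (\<lambda>w. dot J (mat 1) (dot J u \<psi> v) w) ` pattern_group J"
    by (auto simp: right_orbit_def)
  also have "\<dots> = (\<lambda>w. dot J u \<psi> w) ` (\<lambda>w. v ** w) ` pattern_group J"
    unfolding image_image using uv by (intro image_cong refl) (simp add: dot_dot pattern_group_one)
  also have "\<dots> = (\<lambda>w. dot J u (dot J (mat 1) \<psi> w) (mat 1)) ` pattern_group J"
    unfolding translate_image[OF uv(2)]
    using uv by (intro image_cong refl) (simp add: dot_dot pattern_group_one)
  also have "\<dots> = (\<lambda>\<phi>. dot J u \<phi> (mat 1)) ` right_orbit J \<psi>"
    by (auto simp: right_orbit_def)
  finally show ?thesis .
qed

text \<open>
  The isomorphisms are right multiplication by \<open>v\<close> for the left modules, and left multiplication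
  by \<open>u\<close> for the right modules.
\<close>

lemma isomorphic_of_dot:
  fixes \<psi> :: "('a::{field,finite}, 'n) mchar"
  assumes u: "u \<in> pattern_group J" and v: "v \<in> pattern_group J" and \<psi>: "\<psi> \<in> dual J"
  shows "left_isomorphic J (orbit_module (left_orbit J \<psi>)) (orbit_module (left_orbit J (dot J u \<psi> v)))"
    and "right_isomorphic J (orbit_module (right_orbit J \<psi>)) (orbit_module (right_orbit J (dot J u \<psi> v)))"
proof -
  show "left_isomorphic J (orbit_module (left_orbit J \<psi>)) (orbit_module (left_orbit J (dot J u \<psi> v)))"
    unfolding left_isomorphic_def left_orbit_dot[OF u v]
    by (rule module_isomorphic_monomial[where mul = "left_mult J" and c = "\<lambda>\<psi>. \<psi> (matrix_inv v - mat 1)"])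
      (auto simp: left_act_def bij_betw_imp_inj_on[OF dot_bij] pattern_group_one v weight_nonzero
        left_right_commute right_mult_monomial[symmetric] left_orbit_def dot_in_dual \<psi>)
  show "right_isomorphic J (orbit_module (right_orbit J \<psi>)) (orbit_module (right_orbit J (dot J u \<psi> v)))"
    unfolding right_isomorphic_def right_orbit_dot[OF u v]
    by (rule module_isomorphic_monomial[where mul = "right_mult J" and c = "\<lambda>\<psi>. \<psi> (matrix_inv u - mat 1)"])
      (auto simp: right_act_def bij_betw_imp_inj_on[OF dot_bij] pattern_group_one u weight_nonzero
        left_right_commute left_mult_monomial[symmetric] right_orbit_def dot_in_dual \<psi>)
qed

lemma left_act_single:
  fixes u :: "('a::{field,finite}, 'n) square_matrix"
  assumes "u \<in> pattern_group J"
  shows "(\<lambda>w. if w = u then a else 0) \<in> group_algebra J"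
    and "left_act J (\<lambda>w. if w = u then a else 0) f = (\<lambda>\<phi>. a * left_mult J u f \<phi>)"
proof -
  show "(\<lambda>w. if w = u then a else 0) \<in> group_algebra J"
    using assms by (auto simp: group_algebra_def)
  have "(\<Sum>w\<in>pattern_group J. (if w = u then a else 0) * left_mult J w f \<phi>)
      = (\<Sum>w\<in>pattern_group J. if w = u then a * left_mult J u f \<phi> else 0)" for \<phi>
    by (rule sum.cong) auto
  then show "left_act J (\<lambda>w. if w = u then a else 0) f = (\<lambda>\<phi>. a * left_mult J u f \<phi>)"
    using assms by (auto simp: left_act_def)
qed

text \<open>
  Let \<open>\<phi>\<close> occur with nonzero coefficient in the image \<open>h\<close> of the basis vector \<open>\<psi>\<close>. If \<open>u\<close> fixes
  \<open>\<psi>\<close>, then \<open>u h = \<psi>(u\<^sup>-\<^sup>1 - E) h\<close>; if it also fixes \<open>\<phi>\<close>, comparing coefficients at \<open>\<phi>\<close> gives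
  \<open>\<psi>(u\<^sup>-\<^sup>1 - E) = \<phi>(u\<^sup>-\<^sup>1 - E)\<close>. Were the biorbits of \<open>\<psi>\<close> and \<open>\<phi>\<close> distinct, the sum of
  \<open>\<psi> cnj \<phi>\<close> over the common annihilator would be zero, but it counts the elements of a set
  that contains \<open>0\<close>.
\<close>

lemma biorbit_eq_of_left_isomorphic:
  fixes \<psi> \<eta> :: "('a::{field,finite}, 'n) mchar"
  assumes \<psi>: "\<psi> \<in> dual J" and \<eta>: "\<eta> \<in> dual J"
    and iso: "left_isomorphic J (orbit_module (left_orbit J \<psi>)) (orbit_module (left_orbit J \<eta>))"
  shows "biorbit J \<psi> = biorbit J \<eta>"
proof -
  let ?M = "orbit_module (left_orbit J \<psi>)" and ?N = "orbit_module (left_orbit J \<eta>)"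
  obtain F where F: "bij_betw F ?M ?N"
    and add: "\<And>f g. f \<in> ?M \<Longrightarrow> g \<in> ?M \<Longrightarrow> F (\<lambda>\<phi>. f \<phi> + g \<phi>) = (\<lambda>\<phi>. F f \<phi> + F g \<phi>)"
    and equiv: "\<And>x f. x \<in> group_algebra J \<Longrightarrow> f \<in> ?M \<Longrightarrow> F (left_act J x f) = left_act J x (F f)"
    using iso unfolding left_isomorphic_def module_isomorphic_def by blast
  define h where "h = F (basis_vec \<psi>)"
  have "\<psi> \<in> left_orbit J \<psi>"
    using dot_one[OF \<psi>] pattern_group_one unfolding left_orbit_def
    by (metis (mono_tags, lifting) mem_Collect_eq)
  then have M: "basis_vec \<psi> \<in> ?M" "(\<lambda>_. 0) \<in> ?M"
    by (auto simp: orbit_module_def basis_vec_def)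
  have "F (\<lambda>_. 0) = (\<lambda>_. 0)"
    using add[OF M(2) M(2)] by (simp add: fun_eq_iff)
  moreover have "basis_vec \<psi> \<noteq> (\<lambda>_. 0)"
    by (auto simp: basis_vec_def fun_eq_iff)
  ultimately have "h \<noteq> (\<lambda>_. 0)"
    using inj_onD[OF bij_betw_imp_inj_on[OF F], OF _ M] by (auto simp: h_def)
  then obtain \<phi> where h\<phi>: "h \<phi> \<noteq> 0" by auto
  moreover have "h \<in> ?N"
    using bij_betw_apply[OF F M(1)] by (simp add: h_def)
  ultimately have "\<phi> \<in> left_orbit J \<eta>"
    by (auto simp: orbit_module_def)
  then obtain w where w: "w \<in> pattern_group J" "\<phi> = dot J w \<eta> (mat 1)"
    by (auto simp: left_orbit_def)
  then have \<phi>: "\<phi> \<in> dual J"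
    by (simp add: dot_in_dual pattern_group_one \<eta>)
  have eval: "left_mult J u h \<phi> = \<phi> (matrix_inv u - mat 1) * h \<phi>"
    if "u \<in> pattern_group J" "dot J u \<phi> (mat 1) = \<phi>" for u
    using monomial_map_image[OF V.finite_linear_characters
        bij_betw_imp_inj_on[OF dot_bij[OF that(1) pattern_group_one]] \<phi>,
        of "\<lambda>\<psi>. \<psi> (matrix_inv u - mat 1)" h]
    unfolding left_mult_monomial that(2) .
  have agree: "\<psi> (matrix_inv u - mat 1) = \<phi> (matrix_inv u - mat 1)"
    if u: "u \<in> pattern_group J" "dot J u \<psi> (mat 1) = \<psi>" "dot J u \<phi> (mat 1) = \<phi>" for u
  proof -
    let ?c = "\<psi> (matrix_inv u - mat 1)"
    (* The scalar c is the element c E of the group algebra, so that the module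
       isomorphism F is seen to respect it. *)
    have "left_act J (\<lambda>w. if w = u then 1 else 0) (basis_vec \<psi>)
        = left_act J (\<lambda>w. if w = mat 1 then ?c else 0) (basis_vec \<psi>)"
      unfolding left_act_single(2)[OF u(1)] left_act_single(2)[OF pattern_group_one]
      by (simp add: left_mult_monomial monomial_map_basis_vec \<psi> u dot_one inverse_one
          V.character_zero)
    then have "left_act J (\<lambda>w. if w = u then 1 else 0) h
       = left_act J (\<lambda>w. if w = mat 1 then ?c else 0) h"
      unfolding h_def
      equiv[OF left_act_single(1)[OF u(1)] M(1), symmetric]
      equiv[OF left_act_single(1)[OF pattern_group_one] M(1), symmetric]
    by (rule arg_cong)
    then have "left_mult J u h \<phi> = ?c * left_mult J (mat 1) h \<phi>"
      unfolding left_act_single(2)[OF u(1)] left_act_single(2)[OF pattern_group_one] by (simp add: fun_eq_iff)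
    then show ?thesis
      using h\<phi> by (simp add: eval u pattern_group_one dot_one \<phi> inverse_one V.character_zero)
  qed
  have "biorbit J \<psi> = biorbit J \<phi>"
  proof (rule ccontr)
    assume ne: "biorbit J \<psi> \<noteq> biorbit J \<phi>"
    let ?L = "{C\<in>pattern_space J. (\<forall>B\<in>pattern_space J. \<psi> (C ** B) = 1) \<and>
           (\<forall>B\<in>pattern_space J. \<phi> (C ** B) = 1)}"
    have "\<psi> C * cnj (\<phi> C) = 1" if C: "C \<in> ?L" for C
    proof -
      obtain u where u: "u \<in> pattern_group J" "C = matrix_inv u - mat 1"
        using bij_betw_imp_surj_on[OF inverse_minus_one_bij] C by blast
      then have "\<psi> C = \<phi> C"
        using agree[OF u(1)] C by (simp add: left_stabilizer \<psi> \<phi>)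
      then show ?thesis using V.character_cnj[OF \<phi>] C by simp
    qed
    then have "of_nat (card ?L) = (0::complex)"
      using left_annihilator_sum[OF \<psi> \<phi> ne] by simp
    moreover have "0 \<in> ?L"
      using V.zero by (simp add: V.character_zero[OF \<psi>] V.character_zero[OF \<phi>] times0_left)
    moreover have "finite ?L"
      by (rule finite_subset[OF _ V.finite]) blast
    ultimately show False
      using card_gt_0_iff[of ?L] by (auto simp only: of_nat_eq_0_iff)
  qed
  also have "biorbit J \<phi> = biorbit J \<eta>"
    by (rule biorbit_eq_of_dot_eq[OF pattern_group_one pattern_group_one w(1) pattern_group_one \<phi> \<eta>])
      (simp only: dot_one[OF \<phi>] w(2)[symmetric])
  finally show ?thesis .
qed

lemma mchar_of_in_dual:
  fixes A :: "('a::{field,finite}, 'n) square_matrix"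
  assumes "\<theta> \<in> linear_characters UNIV"
  shows "mchar_of \<theta> J A \<in> dual J"
proof -
  have "star J A (B + C) = star J A B + star J A C" for B C
    by (auto simp: star_def sum.distrib[symmetric] algebra_simps intro!: sum.cong)
  then show ?thesis
    using assms by (auto simp: linear_characters_def mchar_of_def V.add)
qed

end

theorem corollary2p16:
  fixes J :: "('n::{finite,linorder} \<times> 'n) set" and \<theta> :: "'a::{field,finite} \<Rightarrow> complex"
  assumes "J \<subseteq> positive_roots" and "trans J"
    and "\<theta> \<in> linear_characters UNIV" and "\<exists>x. \<theta> x \<noteq> 1"
  shows "(\<forall>A\<in>pattern_space J. \<forall>B\<in>pattern_space J.
      left_isomorphic J (orbit_module (left_orbit J (mchar_of \<theta> J A)))
                        (orbit_module (left_orbit J (mchar_of \<theta> J B))) \<and>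
      right_isomorphic J (orbit_module (right_orbit J (mchar_of \<theta> J A)))
                         (orbit_module (right_orbit J (mchar_of \<theta> J B))) \<longleftrightarrow>
      biorbit J (mchar_of \<theta> J A) = biorbit J (mchar_of \<theta> J B)) \<and>
    (\<forall>X\<in>biorbits J. \<forall>Y\<in>(biorbits J :: ('a, 'n) mchar set set). X \<noteq> Y \<longrightarrow>
      character_inner J (left_character J X) (left_character J Y) = 0 \<and>
      character_inner J (right_character J X) (right_character J Y) = 0)"
proof (intro conjI ballI impI)
  note J = assms(1,2)
  fix A B :: "('a, 'n) square_matrix"
  let ?\<psi> = "mchar_of \<theta> J A" and ?\<eta> = "mchar_of \<theta> J B"
  have dual: "?\<psi> \<in> dual J" "?\<eta> \<in> dual J"
    by (rule mchar_of_in_dual[OF J assms(3)])+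
  show "left_isomorphic J (orbit_module (left_orbit J ?\<psi>)) (orbit_module (left_orbit J ?\<eta>)) \<and>
      right_isomorphic J (orbit_module (right_orbit J ?\<psi>)) (orbit_module (right_orbit J ?\<eta>)) \<longleftrightarrow>
      biorbit J ?\<psi> = biorbit J ?\<eta>" (is "?iso \<longleftrightarrow> ?eq")
  proof
    assume ?iso
    then show ?eq using biorbit_eq_of_left_isomorphic[OF J dual] by blast
  next
    assume ?eq
    then have "?\<eta> \<in> biorbit J ?\<psi>" using self_in_biorbit[OF J dual(2)] by simp
    then obtain u v where "u \<in> pattern_group J" "v \<in> pattern_group J" "?\<eta> = dot J u ?\<psi> v"
      by (auto simp: biorbit_def)
    then show ?iso using isomorphic_of_dot[OF J _ _ dual(1)] by simp
  qed
next
  note J = assms(1,2)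
  fix X Y :: "('a, 'n) mchar set"
  assume "X \<in> biorbits J" "Y \<in> biorbits J" and ne: "X \<noteq> Y"
  then obtain \<psi> \<phi> where \<psi>: "\<psi> \<in> dual J" "X = biorbit J \<psi>" and \<phi>: "\<phi> \<in> dual J" "Y = biorbit J \<phi>"
    by (auto simp: biorbits_def)
  show "character_inner J (left_character J X) (left_character J Y) = 0"
    and "character_inner J (right_character J X) (right_character J Y) = 0"
    using biorbit_characters_orthogonal[OF J \<psi>(1) \<phi>(1)] ne by (simp_all add: \<psi>(2) \<phi>(2))
qed

end
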